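(* Let $X,Y$ be Hilbert spaces and $A\colon X\to Y$ a bounded linear operator. Let $\mathbf L=\mathrm{Id}_X+(\mathrm{Id}_X-A^+A)\mathbf N$ be a null space network, with $\Phi:=(\mathrm{Id}_X-A^+A)\mathbf N$ Lipschitz continuous, and set $\mathcal M:=\mathbf L(\operatorname{ran}(A^+))$. Suppose $((B_\alpha)_{\alpha>0},\alpha^\star)$ is a classical regularization method for $Ax=y$. Moreover, let $(Q_\alpha)_{\alpha>0}$ be a family of bounded linear operators on $X$ with $\|Q_\alpha-P_{\ker(A)}\|\to0$ as $\alpha\to0$. Then the pair $((R_\alpha)_{\alpha>0},\alpha^\star)$ with $$R_\alpha:=(\mathrm{Id}_X+Q_\alpha\mathbf N)\circ B_\alpha$$ is an $\mathcal M$-regularization method for $Ax=y$. In particular, the family $(R_\alpha)_{\alpha>0}$ is a regularization of $A^{\mathcal M}$.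
   Context: $A^+\colon\operatorname{dom}(A^+)\subseteq Y\to X$ denotes the Moore-Penrose generalized inverse of $A$, with $\operatorname{dom}(A^+)=\operatorname{ran}(A)\oplus\operatorname{ran}(A)^\perp$; $A^+y$ is the minimal norm solution of $A^*Ax=A^*y$. $P_{\ker(A)}=\mathrm{Id}_X-A^+A$ is the orthogonal projector onto $\ker(A)$. Layered feed forward network: for Hilbert spaces $X,Z$, a function $\mathbf N\colon X\to Z$ of the form $\mathbf N=\sigma_L\circ\mathbf W_L\circ\sigma_{L-1}\circ\mathbf W_{L-1}\circ\cdots\circ\sigma_1\circ\mathbf W_1$ with $L\in\mathbb N$, where $X_0=X,X_1,\dots,X_L=Z$ are Hilbert spaces, $\mathbf W_\ell\colon X_{\ell-1}\to X_\ell$ are affine and continuous, and $\sigma_\ell\colon X_\ell\to X_\ell$ are continuous. Null space network: a function $\mathbf L\colon X\to X$ of the form $\mathbf L=\mathrm{Id}_X+(\mathrm{Id}_X-A^+A)\mathbf N$ with $\mathbf N\colon X\to X$ a layered feed forward network. The $\mathcal M$-generalized inverse of $A$ is $A^{\mathcal M}\colon\operatorname{dom}(A^+)\to X$, $A^{\mathcal M}y:=(\mathrm{Id}_X+\Phi)(A^+y)=\mathbf L(A^+y)$. $\mathcal M$-regularization method: let $(R_\alpha)_{\alpha>0}$ be a family of continuous (not necessarily linear) maps $R_\alpha\colon Y\to X$ and let $\alpha^\star\colon(0,\infty)\times Y\to(0,\infty)$. The pair $((R_\alpha)_{\alpha>0},\alpha^\star)$ is an $\mathcal M$-regularization method for $Ax=y$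 if (i) for all $y\in Y$: $\lim_{\delta\to0}\sup\{\alpha^\star(\delta,y^\delta)\mid y^\delta\in Y,\ \|y^\delta-y\|\le\delta\}=0$; and (ii) for all $y\in\operatorname{dom}(A^+)$: $\lim_{\delta\to0}\sup\{\|A^{\mathcal M}y-R_{\alpha^\star(\delta,y^\delta)}(y^\delta)\|\mid y^\delta\in Y,\ \|y^\delta-y\|\le\delta\}=0$. In that case $(R_\alpha)_{\alpha>0}$ is called a regularization of $A^{\mathcal M}$ and $\alpha^\star$ an admissible parameter choice. A classical regularization method is the special case $\Phi=0$ (so $\mathcal M=\operatorname{ran}(A^+)$ and $A^{\mathcal M}=A^+$). *)

theory Defs
  imports "HOL-Analysis.Analysis"
begin

text \<open>
  Hilbert spaces are types of class \<open>{real_inner, complete_space}\<close>. A complex Hilbert space is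
  covered through its real structure (inner product \<open>Re \<langle>x, y\<rangle>\<close>): complex linear, affine and
  continuous maps are real linear, affine and continuous, and orthogonal complements of complex
  subspaces, adjoints and hence Moore-Penrose inverses agree.
\<close>

definition pinv_dom :: "('a::real_inner \<Rightarrow> 'b::real_inner) \<Rightarrow> 'b set" where
  "pinv_dom A = {u + v | u v. u \<in> range A \<and> v \<in> (range A)\<^sup>\<bottom>}"

text \<open>The value of \<open>pinv A y\<close> is meaningful only for \<open>y \<in> pinv_dom A\<close>.\<close>

definition pinv :: "('a::real_inner \<Rightarrow> 'b::real_inner) \<Rightarrow> 'b \<Rightarrow> 'a" where
  "pinv A y = (ARG_MIN norm x. adjoint A (A x) = adjoint A y)"

definition pinv_ran :: "('a::real_inner \<Rightarrow> 'b::real_inner) \<Rightarrow> 'a set" where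
  "pinv_ran A = pinv A ` pinv_dom A"

definition ker_proj :: "('a::real_inner \<Rightarrow> 'b::real_inner) \<Rightarrow> 'a \<Rightarrow> 'a" where
  "ker_proj A x = x - pinv A (A x)"


definition affine_map_on :: "'p::real_vector set \<Rightarrow> ('p \<Rightarrow> 'q::real_vector) \<Rightarrow> bool" where
  "affine_map_on V W \<longleftrightarrow>
     (\<forall>x\<in>V. \<forall>y\<in>V. \<forall>s t. s + t = 1 \<longrightarrow> W (s *\<^sub>R x + t *\<^sub>R y) = s *\<^sub>R W x + t *\<^sub>R W y)"

text \<open>
  A layer \<open>f = \<sigma> \<circ> W\<close> between Hilbert spaces that are given as closed subspaces \<open>V\<close>, \<open>V'\<close> of types.
\<close>

definition network_layer ::
    "'p::real_normed_vector set \<Rightarrow> 'q::real_normed_vector set \<Rightarrow> ('p \<Rightarrow> 'q) \<Rightarrow> bool" where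
  "network_layer V V' f \<longleftrightarrow>
     (\<exists>W \<sigma>. affine_map_on V W \<and> continuous_on V W \<and> W ` V \<subseteq> V' \<and>
            continuous_on V' \<sigma> \<and> \<sigma> ` V' \<subseteq> V' \<and>
            (\<forall>x\<in>V. f x = \<sigma> (W x)))"

text \<open>
  A network has arbitrarily many, possibly different, intermediate Hilbert spaces
  \<open>X\<^sub>1, \<dots>, X\<^bsub>L-1\<^esub>\<close>. HOL cannot quantify over a sequence of types, so the intermediate spaces are
  arbitrary closed subspaces of one Hilbert space type \<open>'h\<close>, which is an extra (universally
  quantified) type parameter. This is no restriction: any finite family of Hilbert spaces embeds
  isometrically into its Hilbert space direct sum. Here \<open>hidden_network g V\<close> says that
  \<open>g = \<sigma>\<^sub>l \<circ> W\<^sub>l \<circ> \<dots> \<circ> \<sigma>\<^sub>1 \<circ> W\<^sub>1\<close> for some \<open>l \<ge> 1\<close>, with last space \<open>X\<^sub>l = V\<close>.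
\<close>

inductive hidden_network ::
    "('a::real_normed_vector \<Rightarrow> 'h::{real_inner,complete_space}) \<Rightarrow> 'h set \<Rightarrow> bool" where
  first: "\<lbrakk>subspace V; closed V; network_layer UNIV V f\<rbrakk> \<Longrightarrow> hidden_network f V"
| step: "\<lbrakk>hidden_network g V; subspace V'; closed V'; network_layer V V' f\<rbrakk>
           \<Longrightarrow> hidden_network (f \<circ> g) V'"

text \<open>The two disjuncts are the cases \<open>L = 1\<close> and \<open>L \<ge> 2\<close>.\<close>

definition layered_network ::
    "'h::{real_inner,complete_space} itself \<Rightarrow>
     ('a::{real_inner,complete_space} \<Rightarrow> 'c::{real_inner,complete_space}) \<Rightarrow> bool" where
  "layered_network _ N \<longleftrightarrow>
     network_layer UNIV UNIV N \<or>
     (\<exists>g (V :: 'h set) f. hidden_network g V \<and> network_layer V UNIV f \<and> N = f \<circ> g)"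

definition null_space_network ::
    "('a::real_inner \<Rightarrow> 'b::real_inner) \<Rightarrow> ('a \<Rightarrow> 'a) \<Rightarrow> 'a \<Rightarrow> 'a" where
  "null_space_network A N x = x + ker_proj A (N x)"


text \<open>The generalized inverse \<open>A\<^sup>M\<close> (on \<open>pinv_dom A\<close>), where \<open>M = (Id + \<Phi>)(ran A\<^sup>+)\<close>.\<close>

definition gen_inverse ::
    "('a::real_inner \<Rightarrow> 'b::real_inner) \<Rightarrow> ('a \<Rightarrow> 'a) \<Rightarrow> 'b \<Rightarrow> 'a" where
  "gen_inverse A \<Phi> y = pinv A y + \<Phi> (pinv A y)"

text \<open>
  Suprema are taken in the extended reals, since the set may be unbounded for some \<open>\<delta>\<close>. The set
  \<open>M\<close> enters the definition only through \<open>A\<^sup>M\<close>, that is through \<open>\<Phi>\<close>; the first conjunct links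
  the two. \<open>R \<alpha>\<close> for \<open>\<alpha> \<le> 0\<close> and \<open>\<alpha>s \<delta> z\<close> for \<open>\<delta> \<le> 0\<close> are irrelevant.
\<close>

definition M_regularization_method ::
    "('a::real_inner \<Rightarrow> 'b::real_inner) \<Rightarrow> 'a set \<Rightarrow> ('a \<Rightarrow> 'a) \<Rightarrow>
     (real \<Rightarrow> 'b \<Rightarrow> 'a) \<Rightarrow> (real \<Rightarrow> 'b \<Rightarrow> real) \<Rightarrow> bool" where
  "M_regularization_method A M \<Phi> R \<alpha>s \<longleftrightarrow>
     M = (\<lambda>x. x + \<Phi> x) ` pinv_ran A \<and>
     (\<forall>\<alpha>>0. continuous_on UNIV (R \<alpha>)) \<and>
     (\<forall>\<delta>>0. \<forall>z. \<alpha>s \<delta> z > 0) \<and>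
     (\<forall>y. ((\<lambda>\<delta>. SUP z\<in>{z. norm (z - y) \<le> \<delta>}. ereal (\<alpha>s \<delta> z)) \<longlongrightarrow> 0) (at_right 0)) \<and>
     (\<forall>y\<in>pinv_dom A.
        ((\<lambda>\<delta>. SUP z\<in>{z. norm (z - y) \<le> \<delta>}.
                 ereal (norm (gen_inverse A \<Phi> y - R (\<alpha>s \<delta> z) z))) \<longlongrightarrow> 0) (at_right 0))"

definition regularization_of_gen_inverse ::
    "('a::real_inner \<Rightarrow> 'b::real_inner) \<Rightarrow> 'a set \<Rightarrow> ('a \<Rightarrow> 'a) \<Rightarrow>
     (real \<Rightarrow> 'b \<Rightarrow> 'a) \<Rightarrow> bool" where
  "regularization_of_gen_inverse A M \<Phi> R \<longleftrightarrow> (\<exists>\<alpha>s. M_regularization_method A M \<Phi> R \<alpha>s)"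

definition classical_regularization_method ::
    "('a::real_inner \<Rightarrow> 'b::real_inner) \<Rightarrow>
     (real \<Rightarrow> 'b \<Rightarrow> 'a) \<Rightarrow> (real \<Rightarrow> 'b \<Rightarrow> real) \<Rightarrow> bool" where
  "classical_regularization_method A B \<alpha>s \<longleftrightarrow>
     M_regularization_method A (pinv_ran A) (\<lambda>x. 0) B \<alpha>s"

end

theory Submission
  imports Defs
begin

text \<open>
  Put \<open>x = A\<^sup>+ y\<close> and \<open>x' = B\<^sub>\<alpha> z\<close>, with \<open>P\<close> the projector onto the kernel of \<open>A\<close>. Then
  \<open>R\<^sub>\<alpha> z - A\<^sup>M y = (x' - x) + (\<Phi> x' - \<Phi> x) + (Q\<^sub>\<alpha> - P) (N x')\<close>. The first term is small uniformly
  in \<open>z\<close> because \<open>B\<close> is a regularization, the second by the Lipschitz condition. For the third,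
  \<open>\<Phi>\<close> Lipschitz says nothing about \<open>N\<close> itself, but \<open>N\<close> is continuous and so bounded
  near \<open>x\<close>, while \<open>Q\<^sub>\<alpha> - P\<close> tends to \<open>0\<close> in operator norm.
\<close>

section \<open>Projections and adjoints in Hilbert space\<close>

text \<open>Two near-minimizers must be close to each other, since otherwise the parallelogram law
  would make their midpoint, which lies in \<open>S\<close> by convexity, too short. So the sets
  \<open>T n\<close> of near-minimizers shrink to a point, which exists by completeness.\<close>

lemma closed_convex_min_norm:
  fixes S :: "'a::{real_inner,complete_space} set"
  assumes "closed S" "convex S" "S \<noteq> {}"
  obtains p where "p \<in> S" "\<And>x. x \<in> S \<Longrightarrow> norm p \<le> norm x"
proof -
  define d where "d = (INF x\<in>S. (norm x)\<^sup>2)"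
  have bdd: "bdd_below ((\<lambda>x. (norm x)\<^sup>2) ` S)"
    by (rule bdd_belowI[of _ 0]) auto
  have d_le: "d \<le> (norm x)\<^sup>2" if "x \<in> S" for x
    unfolding d_def by (rule cINF_lower[OF bdd that])
  define T where "T n = {x \<in> S. (norm x)\<^sup>2 \<le> d + inverse (real (Suc n))}" for n
  have closed: "closed (T n)" for n
  proof -
    have "T n = S \<inter> {x. (norm x)\<^sup>2 \<le> d + inverse (real (Suc n))}"
      by (auto simp: T_def)
    moreover have "closed {x::'a. (norm x)\<^sup>2 \<le> d + inverse (real (Suc n))}"
      by (intro closed_Collect_le continuous_intros)
    ultimately show ?thesis
      using \<open>closed S\<close> by auto
  qed
  have ne: "T n \<noteq> {}" for n
  proof -
    have "d < d + inverse (real (Suc n))"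
      by simp
    then obtain x where "x \<in> S" "(norm x)\<^sup>2 < d + inverse (real (Suc n))"
      using cINF_less_iff[OF \<open>S \<noteq> {}\<close> bdd] unfolding d_def by blast
    then show ?thesis
      by (auto simp: T_def intro: less_imp_le)
  qed
  have dec: "T n \<subseteq> T m" if "m \<le> n" for m n
  proof -
    have "inverse (real (Suc n)) \<le> inverse (real (Suc m))"
      using that by (intro le_imp_inverse_le) auto
    then show ?thesis
      unfolding T_def by (auto intro: order_trans)
  qed
  have small: "\<exists>n. \<forall>x\<in>T n. \<forall>y\<in>T n. dist x y < e" if "e > 0" for e
  proof -
    \<comment> \<open>The parallelogram law bounds squared distances in \<open>T n\<close> by four
      times the slack \<open>inverse (real (Suc n))\<close>, hence the divisor 4.\<close>
    obtain n where n: "inverse (real (Suc n)) < e\<^sup>2 / 4"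
      using reals_Archimedean[of "e\<^sup>2 / 4"] \<open>e > 0\<close> by auto
    have "dist x y < e" if "x \<in> T n" "y \<in> T n" for x y
    proof -
      have "(1/2) *\<^sub>R x + (1/2) *\<^sub>R y \<in> S"
        using that \<open>convex S\<close> by (intro convexD) (auto simp: T_def)
      then have "d \<le> (norm ((1/2) *\<^sub>R x + (1/2) *\<^sub>R y))\<^sup>2"
        by (rule d_le)
      also have "\<dots> = (2 * (norm x)\<^sup>2 + 2 * (norm y)\<^sup>2 - (norm (x - y))\<^sup>2) / 4"
        by (simp add: power2_norm_eq_inner inner_add_left inner_add_right inner_diff_left
            inner_diff_right inner_commute field_simps)
      finally have "(norm (x - y))\<^sup>2 \<le> 4 * inverse (real (Suc n))"
        using that by (simp add: T_def)
      then have "(norm (x - y))\<^sup>2 < e\<^sup>2"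
        using n by linarith
      then show ?thesis
        using \<open>e > 0\<close> by (simp add: dist_norm power2_less_imp_less)
    qed
    then show ?thesis
      by blast
  qed
  obtain p where p: "\<And>n. p \<in> T n"
    using decreasing_closed_nest[OF closed ne dec small] by blast
  have "(\<lambda>n. d + inverse (real (Suc n))) \<longlonglongrightarrow> d + 0"
    by (intro tendsto_intros LIMSEQ_inverse_real_of_nat)
  then have "(norm p)\<^sup>2 \<le> d"
    using p by (intro LIMSEQ_le_const[of _ d]) (auto simp: T_def)
  then have "norm p \<le> norm x" if "x \<in> S" for x
    by (rule power2_le_imp_le[OF order_trans[OF _ d_le[OF that]] norm_ge_zero])
  moreover have "p \<in> S"
    using p[of 0] by (simp add: T_def)
  ultimately show thesis
    using that by blast
qed

text \<open>The shortest point of the fibre through \<open>x\<close> works: moving it along the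
  kernel stays in the fibre, so the first variation of the norm must vanish there.\<close>

lemma fibre_orthogonal_point:
  fixes f :: "'a::{real_inner,complete_space} \<Rightarrow> 'b::real_normed_vector"
  assumes "bounded_linear f"
  obtains p where "f p = f x" "\<And>w. f w = 0 \<Longrightarrow> p \<bullet> w = 0"
proof -
  interpret bounded_linear f by fact
  have "closed {y. f y = f x}"
    by (intro closed_Collect_eq continuous_intros continuous_on)
  moreover have "convex {y. f y = f x}"
    by (auto simp: convex_def add scaleR scaleR_left_distrib[symmetric])
  ultimately obtain p where p: "p \<in> {y. f y = f x}"
    "\<And>y. y \<in> {y. f y = f x} \<Longrightarrow> norm p \<le> norm y"
    by (rule closed_convex_min_norm) auto
  have "p \<bullet> w = 0" if "f w = 0" for w
  proof (cases "w = 0")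
    case False
    \<comment> \<open>This \<open>t\<close> minimizes the squared norm of
      \<open>p + t *\<^sub>R w\<close>, so a nonzero \<open>p \<bullet> w\<close> would give a
      shorter point of the fibre.\<close>
    define t where "t = - (p \<bullet> w) / (w \<bullet> w)"
    have "f (p + t *\<^sub>R w) = f x"
      using p(1) that by (simp add: add scaleR)
    then have "(norm p)\<^sup>2 \<le> (norm (p + t *\<^sub>R w))\<^sup>2"
      using p(2) by (simp add: power_mono)
    also have "\<dots> = (norm p)\<^sup>2 + 2 * t * (p \<bullet> w) + t\<^sup>2 * (w \<bullet> w)"
      unfolding power2_norm_eq_inner
      by (simp add: inner_add_left inner_add_right inner_commute power2_eq_square)
    also have "\<dots> = (norm p)\<^sup>2 - (p \<bullet> w)\<^sup>2 / (w \<bullet> w)"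
      using False by (simp add: t_def power2_eq_square)
    finally have "(p \<bullet> w)\<^sup>2 / (w \<bullet> w) \<le> 0"
      by simp
    then show ?thesis
      using False by (auto simp: divide_le_0_iff dest: leD)
  qed auto
  with p(1) show thesis
    by (intro that[of p]) auto
qed

text \<open>The kernel of a nonzero functional has codimension one, so a nonzero \<open>p\<close>
  orthogonal to it determines \<open>f\<close> up to scaling.\<close>

lemma Riesz_representation:
  fixes f :: "'a::{real_inner,complete_space} \<Rightarrow> real"
  assumes "bounded_linear f"
  shows "\<exists>a. \<forall>x. f x = x \<bullet> a"
proof (cases "\<forall>x. f x = 0")
  case True
  then show ?thesis
    by (intro exI[of _ 0]) auto
next
  case False
  interpret bounded_linear f by fact
  obtain x where "f x \<noteq> 0"
    using False by blast
  obtain p where p: "f p = f x" "\<And>w. f w = 0 \<Longrightarrow> p \<bullet> w = 0"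
    using fibre_orthogonal_point[OF assms] by blast
  have "p \<noteq> 0"
    using p(1) \<open>f x \<noteq> 0\<close> by (auto simp: zero)
  have "f u = u \<bullet> ((f p / (p \<bullet> p)) *\<^sub>R p)" for u
  proof -
    have "f (u - (f u / f p) *\<^sub>R p) = 0"
      using p(1) \<open>f x \<noteq> 0\<close> by (simp add: diff scaleR)
    then have "p \<bullet> (u - (f u / f p) *\<^sub>R p) = 0"
      by (rule p(2))
    then show ?thesis
      using p(1) \<open>f x \<noteq> 0\<close> \<open>p \<noteq> 0\<close> by (simp add: inner_diff_right inner_commute field_simps)
  qed
  then show ?thesis
    by blast
qed

text \<open>\<open>adjoint\<close> is a choice of some map with this identity, so the work is to
  show that one exists; Riesz representation gives its value at each \<open>y\<close>.\<close>

lemma inner_adjoint: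
  fixes A :: "'a::{real_inner,complete_space} \<Rightarrow> 'b::real_inner"
  assumes "bounded_linear A"
  shows "A x \<bullet> y = x \<bullet> adjoint A y"
proof -
  have "\<exists>a. \<forall>x. A x \<bullet> y = x \<bullet> a" for y
    by (intro Riesz_representation bounded_linear_compose[OF bounded_linear_inner_left assms])
  then have "\<exists>g. \<forall>x y. A x \<bullet> y = x \<bullet> g y"
    by metis
  then have "\<forall>x y. A x \<bullet> y = x \<bullet> adjoint A y"
    unfolding adjoint_def by (rule someI_ex)
  then show ?thesis
    by blast
qed

text \<open>Testing the difference of the two sides against \<open>u - v\<close> gives the squared
  norm of \<open>A u - A v\<close>. On the range of \<open>A\<close> this turns the normal equation
  defining \<open>pinv\<close> into membership in a fibre of \<open>A\<close>.\<close>

lemma normal_equation_iff: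
  fixes A :: "'a::{real_inner,complete_space} \<Rightarrow> 'b::real_inner"
  assumes "bounded_linear A"
  shows "adjoint A (A u) = adjoint A (A v) \<longleftrightarrow> A u = A v"
proof
  assume eq: "adjoint A (A u) = adjoint A (A v)"
  have "A (u - v) = A u - A v"
    using assms by (simp add: bounded_linear.linear linear_diff)
  then have "(A u - A v) \<bullet> (A u - A v) = (u - v) \<bullet> adjoint A (A u) - (u - v) \<bullet> adjoint A (A v)"
    by (metis inner_adjoint[OF assms] inner_diff_right)
  then show "A u = A v"
    using eq by simp
qed simp

section \<open>The projector onto the kernel\<close>

text \<open>By Pythagoras, a point of the fibre that is orthogonal to the kernel is strictly shorter
  than every other point there, so the choice made by \<open>ARG_MIN\<close> is forced.\<close>

lemma pinv_image_eqI:
  fixes A :: "'a::{real_inner,complete_space} \<Rightarrow> 'b::real_inner"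
  assumes A: "bounded_linear A" and p: "A p = A x" "\<And>w. A w = 0 \<Longrightarrow> p \<bullet> w = 0"
  shows "pinv A (A x) = p"
proof -
  have less: "norm p < norm y" if "A y = A x" "y \<noteq> p" for y
  proof -
    have "A (y - p) = 0"
      using A p(1) that(1) by (simp add: bounded_linear.linear linear_diff)
    then have "p \<bullet> (y - p) = 0"
      by (rule p(2))
    then have "(norm y)\<^sup>2 = (norm p)\<^sup>2 + (norm (y - p))\<^sup>2"
      by (simp add: power2_norm_eq_inner inner_diff_left inner_diff_right inner_commute)
    then have "(norm p)\<^sup>2 < (norm y)\<^sup>2"
      using that(2) by simp
    then show ?thesis
      by (simp add: power2_less_imp_less)
  qed
  show ?thesis
    unfolding pinv_def normal_equation_iff[OF A] arg_min_def
  proof (rule some_equality)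
    show "is_arg_min norm (\<lambda>y. A y = A x) p"
      using less p(1) by (auto simp: is_arg_min_def dest: less_asym)
    show "y = p" if "is_arg_min norm (\<lambda>y. A y = A x) y" for y
      using that less p(1) by (auto simp: is_arg_min_def)
  qed
qed

lemma
  fixes A :: "'a::{real_inner,complete_space} \<Rightarrow> 'b::real_inner"
  assumes A: "bounded_linear A"
  shows ker_proj_in_kernel: "A (ker_proj A x) = 0"
    and ker_proj_orthogonal: "A w = 0 \<Longrightarrow> (x - ker_proj A x) \<bullet> w = 0"
proof -
  obtain p where p: "A p = A x" "\<And>w. A w = 0 \<Longrightarrow> p \<bullet> w = 0"
    using fibre_orthogonal_point[OF A] by blast
  then have "ker_proj A x = x - p"
    by (simp add: ker_proj_def pinv_image_eqI[OF A])
  with p show "A (ker_proj A x) = 0" "A w = 0 \<Longrightarrow> (x - ker_proj A x) \<bullet> w = 0"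
    using A by (simp_all add: bounded_linear.linear linear_diff)
qed

text \<open>Membership in the kernel and orthogonality of the remainder determine the projection.
  Linearity of \<open>ker_proj\<close>, not visible from the minimization defining
  \<open>pinv\<close>, follows from this uniqueness.\<close>

lemma ker_proj_eqI:
  fixes A :: "'a::{real_inner,complete_space} \<Rightarrow> 'b::real_inner"
  assumes A: "bounded_linear A" and "A k = 0" "\<And>w. A w = 0 \<Longrightarrow> (x - k) \<bullet> w = 0"
  shows "ker_proj A x = k"
proof -
  have "pinv A (A x) = x - k"
    using assms by (intro pinv_image_eqI) (auto simp: bounded_linear.linear linear_diff)
  then show ?thesis
    by (simp add: ker_proj_def)
qed

lemma bounded_linear_ker_proj:
  fixes A :: "'a::{real_inner,complete_space} \<Rightarrow> 'b::real_inner"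
  assumes A: "bounded_linear A"
  shows "bounded_linear (ker_proj A)"
proof (rule bounded_linear_intro)
  note orth = ker_proj_orthogonal[OF A]
  interpret bounded_linear A by fact
  show "ker_proj A (x + y) = ker_proj A x + ker_proj A y" for x y
  proof (rule ker_proj_eqI[OF A])
    show "(x + y - (ker_proj A x + ker_proj A y)) \<bullet> w = 0" if "A w = 0" for w
      using orth[OF that, of x] orth[OF that, of y] by (simp add: inner_diff_left inner_add_left)
  qed (simp add: add ker_proj_in_kernel[OF A])
  show "ker_proj A (r *\<^sub>R x) = r *\<^sub>R ker_proj A x" for r x
  proof (rule ker_proj_eqI[OF A])
    show "(r *\<^sub>R x - r *\<^sub>R ker_proj A x) \<bullet> w = 0" if "A w = 0" for w
      using orth[OF that, of x] by (simp add: scaleR_diff_right[symmetric])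
  qed (simp add: scaleR ker_proj_in_kernel[OF A])
  show "norm (ker_proj A x) \<le> norm x * 1" for x
  proof -
    have "(x - ker_proj A x) \<bullet> ker_proj A x = 0"
      by (intro orth ker_proj_in_kernel[OF A])
    then have "(norm x)\<^sup>2 = (norm (ker_proj A x))\<^sup>2 + (norm (x - ker_proj A x))\<^sup>2"
      by (simp add: power2_norm_eq_inner inner_diff_left inner_diff_right inner_commute)
    then have "(norm (ker_proj A x))\<^sup>2 \<le> (norm x)\<^sup>2"
      by simp
    then show ?thesis
      unfolding mult_1_right by (rule power2_le_imp_le) simp
  qed
qed

section \<open>Continuity of networks\<close>

lemma network_layer_continuous:
  assumes "network_layer V V' f"
  shows "continuous_on V f" "f ` V \<subseteq> V'"
proof -
  obtain W \<sigma> where W: "continuous_on V W" "W ` V \<subseteq> V'" "continuous_on V' \<sigma>" "\<sigma> ` V' \<subseteq> V'"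
    and f: "\<forall>x\<in>V. f x = \<sigma> (W x)"
    using assms unfolding network_layer_def by blast
  have "continuous_on V (\<lambda>x. \<sigma> (W x))"
    using W by (intro continuous_on_compose2[of V' \<sigma> V W])
  then show "continuous_on V f"
    using f by (simp cong: continuous_on_cong)
  show "f ` V \<subseteq> V'"
    using W f by auto
qed

text \<open>The inclusion of the range in \<open>V\<close> is carried through the induction because
  the next layer is known to be continuous only on \<open>V\<close>.\<close>

lemma hidden_network_continuous:
  assumes "hidden_network g V"
  shows "continuous_on UNIV g \<and> range g \<subseteq> V"
  using assms
proof induction
  case (first V f)
  then show ?case
    using network_layer_continuous by blast
next
  case (step g V V' f)
  note f = network_layer_continuous[OF \<open>network_layer V V' f\<close>]
  have "continuous_on UNIV (f \<circ> g)"
    using step.IH f(1) by (intro continuous_on_compose) (auto intro: continuous_on_subset)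
  then show ?case
    using step.IH f(2) by auto
qed

lemma layered_network_continuous:
  assumes "layered_network TYPE('h::{real_inner,complete_space}) N"
  shows "continuous_on UNIV N"
  using assms unfolding layered_network_def
proof (elim disjE exE conjE)
  fix g and V :: "'h set" and f
  assume g: "hidden_network g V" and f: "network_layer V UNIV f" and N: "N = f \<circ> g"
  show "continuous_on UNIV N"
    using hidden_network_continuous[OF g] network_layer_continuous(1)[OF f] unfolding N
    by (intro continuous_on_compose) (auto intro: continuous_on_subset)
qed (rule network_layer_continuous)

section \<open>Convergence of regularization methods\<close>

text \<open>For \<open>\<delta> < 0\<close> the ball is empty and the supremum is \<open>-\<infinity>\<close>; only \<open>\<delta> > 0\<close> matters.\<close>

lemma SUP_ball_tendsto_0_iff:
  fixes y :: "'b::real_normed_vector" and g :: "real \<Rightarrow> 'b \<Rightarrow> real"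
  assumes nonneg: "\<And>\<delta> z. \<delta> > 0 \<Longrightarrow> g \<delta> z \<ge> 0"
  shows "((\<lambda>\<delta>. SUP z\<in>{z. norm (z - y) \<le> \<delta>}. ereal (g \<delta> z)) \<longlongrightarrow> 0) (at_right 0) \<longleftrightarrow>
    (\<forall>e>0. \<forall>\<^sub>F \<delta> in at_right 0. \<forall>z. norm (z - y) \<le> \<delta> \<longrightarrow> g \<delta> z < e)"
    (is "(?S \<longlongrightarrow> 0) _ \<longleftrightarrow> ?R")
proof
  assume lim: "(?S \<longlongrightarrow> 0) (at_right 0)"
  show ?R
  proof (intro allI impI)
    fix e :: real
    assume "e > 0"
    then have "\<forall>\<^sub>F \<delta> in at_right 0. ?S \<delta> < ereal e"
      by (intro order_tendstoD(2)[OF lim]) simp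
    then show "\<forall>\<^sub>F \<delta> in at_right 0. \<forall>z. norm (z - y) \<le> \<delta> \<longrightarrow> g \<delta> z < e"
    proof eventually_elim
      case (elim \<delta>)
      have "ereal (g \<delta> z) \<le> ?S \<delta>" if "norm (z - y) \<le> \<delta>" for z
        using that by (intro SUP_upper) simp
      then show ?case
        using elim by (meson le_less_trans less_ereal.simps(1))
    qed
  qed
next
  assume R: ?R
  have pos: "\<forall>\<^sub>F \<delta> in at_right (0::real). \<delta> > 0"
    by (rule eventually_at_right_less)
  show "(?S \<longlongrightarrow> 0) (at_right 0)"
  proof (rule order_tendstoI)
    fix a :: ereal
    assume "a < 0"
    show "\<forall>\<^sub>F \<delta> in at_right 0. a < ?S \<delta>"
      using pos
    proof eventually_elim
      case (elim \<delta>)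
      \<comment> \<open>For \<delta> > 0 the ball contains its centre \<open>y\<close>, so the
        supremum is at least one nonnegative value.\<close>
      have "0 \<le> ereal (g \<delta> y)"
        using nonneg[OF elim] by simp
      also have "\<dots> \<le> ?S \<delta>"
        using elim by (intro SUP_upper) simp
      finally show ?case
        using \<open>a < 0\<close> by (rule less_le_trans[rotated])
    qed
  next
    fix a :: ereal
    assume "a > 0"
    \<comment> \<open>A real number strictly below \<open>a\<close> leaves room for the supremum,
      which turns the pointwise \<open><\<close> into \<open>\<le>\<close>; moreover
      \<open>a\<close> may be infinite.\<close>
    then obtain e where e: "0 < ereal e" "ereal e < a"
      using ereal_dense2 by blast
    then have "\<forall>\<^sub>F \<delta> in at_right 0. \<forall>z. norm (z - y) \<le> \<delta> \<longrightarrow> g \<delta> z < e"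
      using R by simp
    then show "\<forall>\<^sub>F \<delta> in at_right 0. ?S \<delta> < a"
    proof eventually_elim
      case (elim \<delta>)
      then have "?S \<delta> \<le> ereal e"
        by (intro SUP_least) (auto intro: less_imp_le)
      then show ?case
        using e(2) by (rule le_less_trans)
    qed
  qed
qed

theorem theorem3p3:
  fixes A :: "'a::{real_inner,complete_space} \<Rightarrow> 'b::{real_inner,complete_space}"
    and N L \<Phi> :: "'a \<Rightarrow> 'a"
    and M :: "'a set"
    and B R :: "real \<Rightarrow> 'b \<Rightarrow> 'a"
    and \<alpha>s :: "real \<Rightarrow> 'b \<Rightarrow> real"
    and Q :: "real \<Rightarrow> 'a \<Rightarrow> 'a"
  assumes "bounded_linear A"
    and "layered_network TYPE('h::{real_inner,complete_space}) N"
    and "L = null_space_network A N"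
    and "\<Phi> = (\<lambda>x. ker_proj A (N x))"
    and "\<exists>C. lipschitz_on C UNIV \<Phi>"
    and "M = L ` pinv_ran A"
    and "classical_regularization_method A B \<alpha>s"
    and "\<And>\<alpha>. \<alpha> > 0 \<Longrightarrow> bounded_linear (Q \<alpha>)"
    and "((\<lambda>\<alpha>. onorm (\<lambda>x. Q \<alpha> x - ker_proj A x)) \<longlongrightarrow> 0) (at_right 0)"
    and "\<And>\<alpha>. \<alpha> > 0 \<Longrightarrow> R \<alpha> = (\<lambda>x. x + Q \<alpha> (N x)) \<circ> B \<alpha>"
  shows "M_regularization_method A M \<Phi> R \<alpha>s \<and> regularization_of_gen_inverse A M \<Phi> R"
proof -
  note Q = assms(8) and R = assms(10)
  have N: "continuous_on UNIV N"
    using assms(2) by (rule layered_network_continuous)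
  have \<Phi>: "\<Phi> x = ker_proj A (N x)" for x
    by (simp add: assms(4))
  obtain C where C: "lipschitz_on C UNIV \<Phi>"
    using assms(5) by blast
  have pos: "\<alpha>s \<delta> z > 0" if "\<delta> > 0" for \<delta> z
    using assms(7) that
    by (auto simp: classical_regularization_method_def M_regularization_method_def)
  have B: "continuous_on UNIV (B \<alpha>)" if "\<alpha> > 0" for \<alpha>
    using assms(7) that
    by (auto simp: classical_regularization_method_def M_regularization_method_def)
  have \<alpha>_lim: "((\<lambda>\<delta>. SUP z\<in>{z. norm (z - y) \<le> \<delta>}. ereal (\<alpha>s \<delta> z)) \<longlongrightarrow> 0) (at_right 0)" for y
    using assms(7) by (auto simp: classical_regularization_method_def M_regularization_method_def)
  then have \<alpha>_small: "\<forall>\<^sub>F \<delta> in at_right 0. \<forall>z. norm (z - y) \<le> \<delta> \<longrightarrow> \<alpha>s \<delta> z < e" if "e > 0" for e y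
    using SUP_ball_tendsto_0_iff[of \<alpha>s y] pos that by (auto intro: less_imp_le)
  have B_small: "\<forall>\<^sub>F \<delta> in at_right 0. \<forall>z. norm (z - y) \<le> \<delta> \<longrightarrow>
      norm (pinv A y - B (\<alpha>s \<delta> z) z) < e" if "y \<in> pinv_dom A" "e > 0" for y e
  proof -
    \<comment> \<open>In the classical case \<Phi> is zero and \<open>gen_inverse\<close> collapses
      to \<open>pinv\<close>.\<close>
    have "((\<lambda>\<delta>. SUP z\<in>{z. norm (z - y) \<le> \<delta>}.
        ereal (norm (pinv A y - B (\<alpha>s \<delta> z) z))) \<longlongrightarrow> 0) (at_right 0)"
      using assms(7) that(1)
      by (simp add: classical_regularization_method_def M_regularization_method_def
          gen_inverse_def)
    then show ?thesis
      using SUP_ball_tendsto_0_iff[of "\<lambda>\<delta> z. norm (pinv A y - B (\<alpha>s \<delta> z) z)" y] that(2) by simp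
  qed
  have diff: "bounded_linear (\<lambda>x. Q \<alpha> x - ker_proj A x)" if "\<alpha> > 0" for \<alpha>
    using Q[OF that] bounded_linear_ker_proj[OF assms(1)] by (rule bounded_linear_sub)
  have R_small: "\<forall>\<^sub>F \<delta> in at_right 0. \<forall>z. norm (z - y) \<le> \<delta> \<longrightarrow>
      norm (gen_inverse A \<Phi> y - R (\<alpha>s \<delta> z) z) < e" if y: "y \<in> pinv_dom A" and "e > 0" for y e
  proof -
    define x where "x = pinv A y"
    \<comment> \<open>The tolerance 1 is arbitrary: it makes \<open>K\<close> a bound for
      \<open>norm (N x')\<close> on the whole ball of radius \<open>r\<close> about
      \<open>x\<close>, uniformly in the noisy data.\<close>
    obtain r where r: "r > 0" and N_r: "\<And>x'. dist x' x < r \<Longrightarrow> dist (N x') (N x) < 1"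
      using N unfolding continuous_on_iff by (metis UNIV_I zero_less_one)
    define K where "K = norm (N x) + 1"
    have "K > 0"
      by (simp add: K_def add_nonneg_pos)
    have "C \<ge> 0"
      using C by (rule lipschitz_on_nonneg)
    \<comment> \<open>The radius \<open>r\<close> keeps \<open>x'\<close> where \<open>N\<close> is
      bounded by \<open>K\<close>. The other bound makes \<open>(1 + C) * norm (x - x')\<close> less
      than \<open>e / 2\<close>, which covers the first two error terms.\<close>
    define s where "s = min r (e / (2 * (1 + C)))"
    have "s > 0"
      using r \<open>C \<ge> 0\<close> \<open>e > 0\<close> by (simp add: s_def)
    \<comment> \<open>This threshold times \<open>K\<close> is \<open>e / 2\<close>, the share of
      the third error term.\<close>
    have "\<forall>\<^sub>F \<alpha> in at_right 0. onorm (\<lambda>x. Q \<alpha> x - ker_proj A x) < e / (2 * K)"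
      using \<open>K > 0\<close> \<open>e > 0\<close> by (intro order_tendstoD(2)[OF assms(9)]) simp
    then obtain b where b: "b > 0"
      and Q_b: "\<And>\<alpha>. 0 < \<alpha> \<Longrightarrow> \<alpha> < b \<Longrightarrow> onorm (\<lambda>x. Q \<alpha> x - ker_proj A x) < e / (2 * K)"
      unfolding eventually_at_right_field by blast
    \<comment> \<open>\<open>B_small\<close> puts \<open>x'\<close> within \<open>s\<close> of
      \<open>x\<close>, \<open>\<alpha>_small\<close> puts the chosen parameter below
      \<open>b\<close>, and \<delta> > 0 makes that parameter positive, so that the bound on the
      operator norm applies to it.\<close>
    show ?thesis
      using B_small[OF y \<open>s > 0\<close>] \<alpha>_small[OF b, of y] eventually_at_right_less[of 0]
    proof eventually_elim
      case (elim \<delta>)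
      show ?case
      proof (intro allI impI)
        fix z
        assume z: "norm (z - y) \<le> \<delta>"
        define \<alpha> x' where "\<alpha> = \<alpha>s \<delta> z" and "x' = B \<alpha> z"
        have \<alpha>: "0 < \<alpha>" "\<alpha> < b"
          using elim z pos by (auto simp: \<alpha>_def)
        have x': "norm (x - x') < s"
          using elim z by (auto simp: \<alpha>_def x'_def x_def)
        have "dist (N x') (N x) < 1"
          using x' by (intro N_r) (simp add: s_def dist_norm norm_minus_commute)
        then have NK: "norm (N x') \<le> K"
          using norm_triangle_ineq2[of "N x'" "N x"] by (simp add: K_def dist_norm)
        have "norm (Q \<alpha> (N x') - ker_proj A (N x'))
            \<le> onorm (\<lambda>x. Q \<alpha> x - ker_proj A x) * norm (N x')"
          by (rule onorm[OF diff[OF \<alpha>(1)]])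
        also have "\<dots> \<le> (e / (2 * K)) * K"
          using NK Q_b[OF \<alpha>] \<open>e > 0\<close> \<open>K > 0\<close> by (intro mult_mono) auto
        finally have third: "norm (Q \<alpha> (N x') - \<Phi> x') \<le> e / 2"
          using \<open>K > 0\<close> by (simp add: \<Phi>)
        have second: "norm (\<Phi> x - \<Phi> x') \<le> C * norm (x - x')"
          using lipschitz_onD[OF C, of x x'] by (simp add: dist_norm)
        have "norm (x - x') < (e / 2) / (1 + C)"
          using x' by (simp add: s_def)
        then have first: "norm (x - x') + C * norm (x - x') < e / 2"
          using \<open>C \<ge> 0\<close> by (simp add: less_divide_eq algebra_simps)
        have "gen_inverse A \<Phi> y - R (\<alpha>s \<delta> z) z
            = (x - x') + (\<Phi> x - \<Phi> x') - (Q \<alpha> (N x') - \<Phi> x')"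
          using R[OF \<alpha>(1)] by (simp add: gen_inverse_def x_def x'_def \<alpha>_def)
        also have "norm \<dots> \<le> norm (x - x') + norm (\<Phi> x - \<Phi> x') + norm (Q \<alpha> (N x') - \<Phi> x')"
          by (intro order_trans[OF norm_triangle_ineq4] add_right_mono norm_triangle_ineq)
        finally show "norm (gen_inverse A \<Phi> y - R (\<alpha>s \<delta> z) z) < e"
          using first second third by linarith
      qed
    qed
  qed
  have "continuous_on UNIV (R \<alpha>)" if "\<alpha> > 0" for \<alpha>
  proof -
    have "continuous_on UNIV (\<lambda>x. x + Q \<alpha> (N x))"
      by (intro continuous_intros bounded_linear.continuous_on[OF Q[OF that]] N)
    then show ?thesis
      unfolding R[OF that]
      by (intro continuous_on_compose B[OF that]) (rule continuous_on_subset, auto)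
  qed
  moreover have "M = (\<lambda>x. x + \<Phi> x) ` pinv_ran A"
    using assms(3,6) by (simp add: null_space_network_def[abs_def] \<Phi>)
  moreover have "((\<lambda>\<delta>. SUP z\<in>{z. norm (z - y) \<le> \<delta>}.
      ereal (norm (gen_inverse A \<Phi> y - R (\<alpha>s \<delta> z) z))) \<longlongrightarrow> 0) (at_right 0)"
    if "y \<in> pinv_dom A" for y
    using SUP_ball_tendsto_0_iff[of "\<lambda>\<delta> z. norm (gen_inverse A \<Phi> y - R (\<alpha>s \<delta> z) z)" y]
      R_small[OF that] by simp
  ultimately have "M_regularization_method A M \<Phi> R \<alpha>s"
    using pos \<alpha>_lim unfolding M_regularization_method_def by blast
  then show ?thesis
    unfolding regularization_of_gen_inverse_def by blast
qed

end
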